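(* In the screening model described in the context, suppose the conditions of limited feasible recourse ($\bar r<a_L/\delta$ and $K_L(\bar r)<v$) and acceptance dominance at the top ($q_H(r)(a_H+\delta r)\le a_H$ for every $r\in\mathcal R$) hold, and that the upper cutoff is interior, $\bar p<1$. Consider changes in one parameter or cost function at a time (all other primitives held fixed) such that these conditions and all remaining assumptions of the model hold both before and after the change. Then the cutoffs $\underline p$ and $\bar p$ of the tie-broken optimal rule change as follows: (a) A (strictly) higher productivity parameter $\delta$ strictly lowers $\underline p$ and strictly raises $\bar p$. (b) A pointwise weak increase in $K_L$ (replacing $K_L$ by $\widetilde K_L$ with $\widetilde K_L(r)\ge K_L(r)$ for all $r\in\mathcal R$), holding $K_H$ fixed, weakly lowers $\underline p$ and weakly raises $\bar p$. Both movements are strict if $\widetilde K_L(r)>K_L(r)$ for every $r\in\mathcal R$. (c) A (strictly) higher upper bound $\bar\varepsilon$ on the cost shock leaves $\underline p$ unchanged and strictly lowers $\bar p$. (d) A (strictly) higher loss $a_L$ strictly raises both $\underline p$ and $\bar p$. A (strictly) higher gain $a_H$ strictly lowers both $\underline p$ and $\bar p$.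
   Context: Primitives: real numbers $a_H>0$, $a_L>0$, $v>0$, $\delta>0$, $\bar\varepsilon>0$; a compact interval $\mathcal R=[\underline r,\bar r]$ with $0<\underline r\le\bar r$; for each type $\theta\in\{H,L\}$ a twice differentiable function $K_\theta:\mathcal R\to\mathbb R$ with $K_\theta\ge 0$, $K_\theta'>0$, $K_\theta''\ge 0$ on $\mathcal R$ (derivatives one-sided at endpoints), and $K_H(r)\le K_L(r)$ for all $r\in\mathcal R$. Completion probabilities (the probability that $K_\theta(r)+\varepsilon\le v$ when $\varepsilon$ is uniform on $[0,\bar\varepsilon]$): $$q_\theta(r)=\min\left\{\max\left\{\frac{v-K_\theta(r)}{\bar\varepsilon},0\right\},1\right\}.$$ At posterior belief $p\in[0,1]$ (the probability that the applicant is of type $H$), the principal chooses one of: accept ($A$), reject ($R$), or offer recourse with some requirement $r\in\mathcal R$ ($(O,r)$). The payoffs are $$U^A(p)=pa_H-(1-p)a_L,\qquad U^R=0,\qquad U^O(p,r)=p\,q_H(r)(a_H+\delta r)+(1-p)\,q_L(r)(-a_L+\delta r).$$ Let $V^O(p)=\max_{r\in\mathcal R}U^O(p,r)$. Tie-broken optimal action at $p$: accept if $U^A(p)\ge\max\{0,V^O(p)\}$; otherwise offer recourse (with a requirement attaining $V^O(p)$) if $V^O(p)\ge 0$; otherwise reject. Cutoffs: under limited feasible recourse and acceptance dominance at the top, there are unique numbers $0<\underline p<p^A<\bar p\le1$, where $p^A=a_L/(a_H+a_L)$, such that the tie-broken optimal action is rejection exactly on $[0,\underline p)$, recourse exactly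 on $[\underline p,\bar p)$, and acceptance exactly on $[\bar p,1]$. They satisfy $V^O(\underline p)=0$ and $V^O(\bar p)=U^A(\bar p)$. *)

theory Defs
  imports Complex_Main
begin

record screening =
  gain_H :: real
  loss_L :: real
  threshold :: real    (* v: recourse is completed iff cost plus shock is at most this *)
  productivity :: real
  shock_bound :: real  (* the shock is uniform on {0..shock_bound} *)
  r_min :: real
  r_max :: real
  cost_H :: "real \<Rightarrow> real"
  cost_L :: "real \<Rightarrow> real"

abbreviation requirements :: "screening \<Rightarrow> real set" where
  "requirements M \<equiv> {r_min M..r_max M}"

(* Derivatives are taken within S, hence one-sided at the endpoints of an interval.  They are
   given by witnesses because a one-point S, which is allowed, does not determine them. *)
definition cost_function_on :: "real set \<Rightarrow> (real \<Rightarrow> real) \<Rightarrow> bool" where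
  "cost_function_on S K \<longleftrightarrow>
    (\<forall>r\<in>S. K r \<ge> 0) \<and>
    (\<exists>K' K''. \<forall>r\<in>S.
      (K has_real_derivative K' r) (at r within S) \<and>
      (K' has_real_derivative K'' r) (at r within S) \<and>
      K' r > 0 \<and> K'' r \<ge> 0)"

definition screening_model :: "screening \<Rightarrow> bool" where
  "screening_model M \<longleftrightarrow>
    gain_H M > 0 \<and> loss_L M > 0 \<and> threshold M > 0 \<and> productivity M > 0 \<and> shock_bound M > 0 \<and>
    0 < r_min M \<and> r_min M \<le> r_max M \<and>
    cost_function_on (requirements M) (cost_H M) \<and>
    cost_function_on (requirements M) (cost_L M) \<and>
    (\<forall>r\<in>requirements M. cost_H M r \<le> cost_L M r)"

definition completion_prob :: "screening \<Rightarrow> (real \<Rightarrow> real) \<Rightarrow> real \<Rightarrow> real" where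
  "completion_prob M K r = min (max ((threshold M - K r) / shock_bound M) 0) 1"

abbreviation q_H :: "screening \<Rightarrow> real \<Rightarrow> real" where
  "q_H M \<equiv> completion_prob M (cost_H M)"

abbreviation q_L :: "screening \<Rightarrow> real \<Rightarrow> real" where
  "q_L M \<equiv> completion_prob M (cost_L M)"

definition U_A :: "screening \<Rightarrow> real \<Rightarrow> real" where
  "U_A M p = p * gain_H M - (1 - p) * loss_L M"

definition U_O :: "screening \<Rightarrow> real \<Rightarrow> real \<Rightarrow> real" where
  "U_O M p r = p * q_H M r * (gain_H M + productivity M * r)
             + (1 - p) * q_L M r * (- loss_L M + productivity M * r)"

definition V_O :: "screening \<Rightarrow> real \<Rightarrow> real" where
  "V_O M p = (GREATEST u. u \<in> U_O M p ` requirements M)"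

datatype action = Accept | Reject | Offer real

(* The set is a singleton except in the recourse region, where it contains one offer for every
   requirement attaining the maximum. *)
definition optimal_actions :: "screening \<Rightarrow> real \<Rightarrow> action set" where
  "optimal_actions M p =
    (if U_A M p \<ge> max 0 (V_O M p) then {Accept}
     else if V_O M p \<ge> 0 then Offer ` {r \<in> requirements M. U_O M p r = V_O M p}
     else {Reject})"

definition limited_feasible_recourse :: "screening \<Rightarrow> bool" where
  "limited_feasible_recourse M \<longleftrightarrow>
    r_max M < loss_L M / productivity M \<and> cost_L M (r_max M) < threshold M"

definition acceptance_dominance_at_top :: "screening \<Rightarrow> bool" where
  "acceptance_dominance_at_top M \<longleftrightarrow>
    (\<forall>r\<in>requirements M. q_H M r * (gain_H M + productivity M * r) \<le> gain_H M)"

definition admissible :: "screening \<Rightarrow> bool" where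
  "admissible M \<longleftrightarrow>
    screening_model M \<and> limited_feasible_recourse M \<and> acceptance_dominance_at_top M"

definition p_A :: "screening \<Rightarrow> real" where
  "p_A M = loss_L M / (gain_H M + loss_L M)"

definition are_cutoffs :: "screening \<Rightarrow> real \<Rightarrow> real \<Rightarrow> bool" where
  "are_cutoffs M pl pu \<longleftrightarrow>
    0 < pl \<and> pl < p_A M \<and> p_A M < pu \<and> pu \<le> 1 \<and>
    {p \<in> {0..1}. Reject \<in> optimal_actions M p} = {0..<pl} \<and>
    {p \<in> {0..1}. \<exists>r. Offer r \<in> optimal_actions M p} = {pl..<pu} \<and>
    {p \<in> {0..1}. Accept \<in> optimal_actions M p} = {pu..1}"

definition lower_cutoff :: "screening \<Rightarrow> real" where
  "lower_cutoff M = (THE pl. \<exists>pu. are_cutoffs M pl pu)"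

definition upper_cutoff :: "screening \<Rightarrow> real" where
  "upper_cutoff M = (THE pu. \<exists>pl. are_cutoffs M pl pu)"

(* Under the standing assumptions the maximum and the two cutoffs are well defined. *)

lemma cost_function_onD:
  assumes "cost_function_on {a..b} K"
  shows "continuous_on {a..b} K" "\<And>r. r \<in> {a..b} \<Longrightarrow> K r \<le> K b"
proof -
  obtain K' where K': "\<And>r. r \<in> {a..b} \<Longrightarrow> (K has_real_derivative K' r) (at r within {a..b})"
      "\<And>r. r \<in> {a..b} \<Longrightarrow> K' r > 0"
    using assms unfolding cost_function_on_def by blast
  show cont: "continuous_on {a..b} K"
    using K'(1) by (meson DERIV_continuous_on)
  fix r assume r: "r \<in> {a..b}"
  show "K r \<le> K b"
  proof (rule DERIV_nonneg_imp_increasing_open[where f=K and a=r and b=b])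
    show "r \<le> b" using r by simp
    show "continuous_on {r..b} K" using cont r by (auto intro: continuous_on_subset)
    fix x assume x: "r < x" "x < b"
    hence "(K has_real_derivative K' x) (at x)"
      using K'(1)[of x] r by (simp add: at_within_Icc_at)
    moreover have "K' x \<ge> 0" using K'(2)[of x] x r by simp
    ultimately show "\<exists>y. (K has_real_derivative y) (at x) \<and> 0 \<le> y" by blast
  qed
qed

lemma completion_prob_bounds:
  assumes "admissible M" "r \<in> requirements M"
  shows "0 < q_L M r" "q_L M r \<le> q_H M r" "q_H M r \<le> 1" "productivity M * r < loss_L M"
    "0 < productivity M * r"
proof -
  have m: "screening_model M" "limited_feasible_recourse M"
    using assms unfolding admissible_def by auto
  have e: "shock_bound M > 0" "productivity M > 0" "r > 0" using m assms(2) unfolding screening_model_def by auto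
  have "cost_L M r \<le> cost_L M (r_max M)"
    using m assms(2) unfolding screening_model_def by (intro cost_function_onD) auto
  hence "cost_L M r < threshold M" using m(2) unfolding limited_feasible_recourse_def by simp
  thus "0 < q_L M r" using e by (simp add: completion_prob_def)
  have "cost_H M r \<le> cost_L M r" using m assms(2) unfolding screening_model_def by auto
  hence "(threshold M - cost_L M r) / shock_bound M \<le> (threshold M - cost_H M r) / shock_bound M"
    using e by (intro divide_right_mono) auto
  thus "q_L M r \<le> q_H M r" by (simp add: completion_prob_def min_def max_def)
  show "q_H M r \<le> 1" by (simp add: completion_prob_def)
  have "productivity M * r \<le> productivity M * r_max M" using e assms(2) by auto
  also have "\<dots> < loss_L M" using m(2) e unfolding limited_feasible_recourse_def by (simp add: field_simps)
  finally show "productivity M * r < loss_L M" .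
  show "0 < productivity M * r" using e by simp
qed

lemma V_O_attained:
  assumes "admissible M"
  shows "V_O M p \<in> U_O M p ` requirements M" "\<And>r. r \<in> requirements M \<Longrightarrow> U_O M p r \<le> V_O M p"
proof -
  have m: "screening_model M" using assms unfolding admissible_def by auto
  have c: "continuous_on (requirements M) (cost_H M)" "continuous_on (requirements M) (cost_L M)"
    using m cost_function_onD unfolding screening_model_def by auto
  have "continuous_on (requirements M) (U_O M p)"
    unfolding U_O_def completion_prob_def divide_inverse by (intro continuous_intros c)
  moreover have "requirements M \<noteq> {}" using m unfolding screening_model_def by auto
  ultimately obtain s where s: "s \<in> requirements M" "\<And>r. r \<in> requirements M \<Longrightarrow> U_O M p r \<le> U_O M p s"
    using continuous_attains_sup[of "requirements M" "U_O M p"] compact_Icc by blast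
  have "V_O M p = U_O M p s"
    unfolding V_O_def using s by (intro Greatest_equality) auto
  thus "V_O M p \<in> U_O M p ` requirements M" "\<And>r. r \<in> requirements M \<Longrightarrow> U_O M p r \<le> V_O M p"
    using s by auto
qed

lemma cutoffs_exist:
  assumes "admissible M"
  shows "\<exists>pl pu. are_cutoffs M pl pu"
proof -
  let ?V = "V_O M" and ?U = "U_O M" and ?R = "requirements M" and ?A = "U_A M"
  define C where "C = gain_H M + loss_L M"
  have m: "screening_model M" "acceptance_dominance_at_top M"
    using assms unfolding admissible_def by auto
  have pos: "gain_H M > 0" "loss_L M > 0" using m unfolding screening_model_def by auto
  note q = completion_prob_bounds[OF assms]
  note V = V_O_attained[OF assms]
  have aff: "?U p r = (1 - p) * ?U 0 r + p * ?U 1 r" for p r by (simp add: U_O_def algebra_simps)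
  have U0: "?U 0 r < 0" "- loss_L M \<le> ?U 0 r" if "r \<in> ?R" for r
  proof -
    have "q_L M r * (loss_L M - productivity M * r) \<le> 1 * loss_L M"
      using q[OF that] by (intro mult_mono) auto
    moreover have "q_L M r * (loss_L M - productivity M * r) > 0" using q[OF that] by simp
    ultimately show "?U 0 r < 0" "- loss_L M \<le> ?U 0 r" by (auto simp: U_O_def algebra_simps)
  qed
  have U1: "?U 1 r > 0" "?U 1 r \<le> gain_H M" if "r \<in> ?R" for r
    using q[OF that] pos m(2) that unfolding U_O_def acceptance_dominance_at_top_def by auto
  have diff: "?U p' r - ?U p r = (p' - p) * (?U 1 r - ?U 0 r)" for p p' r
    by (subst (1 2) aff) (simp add: algebra_simps)
  have lip1: "?V p' - ?V p \<le> C * \<bar>p' - p\<bar>" for p p'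
  proof -
    obtain r where r: "r \<in> ?R" "?V p' = ?U p' r" using V(1) by blast
    have "?V p' - ?V p \<le> ?U p' r - ?U p r" using V(2)[OF r(1), of p] r by simp
    also have "\<dots> = (p' - p) * (?U 1 r - ?U 0 r)" by (rule diff)
    also have "\<dots> \<le> \<bar>p' - p\<bar> * C"
      using U0[OF r(1)] U1[OF r(1)] unfolding C_def by (intro mult_mono) auto
    finally show ?thesis by (simp add: mult.commute)
  qed
  have cont: "isCont ?V p" for p
  proof -
    have "(\<lambda>x. C * \<bar>x - p\<bar>) \<midarrow>p\<rightarrow> C * \<bar>p - p\<bar>" by (intro tendsto_intros)
    hence t: "(\<lambda>x. C * \<bar>x - p\<bar>) \<midarrow>p\<rightarrow> 0" by simp
    have "(\<lambda>x. ?V x - ?V p) \<midarrow>p\<rightarrow> 0"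
    proof (rule tendsto_rabs_zero_cancel, rule tendsto_sandwich[OF _ _ tendsto_const t])
      show "\<forall>\<^sub>F x in at p. \<bar>?V x - ?V p\<bar> \<le> C * \<bar>x - p\<bar>"
        using lip1[of _ p] lip1[of p] by (intro always_eventually allI) (auto simp: abs_le_iff abs_minus_commute)
    qed auto
    thus ?thesis unfolding isCont_def by (simp add: LIM_zero_iff)
  qed
  have mono: "?V p < ?V p'" if "p < p'" for p p'
  proof -
    obtain r where r: "r \<in> ?R" "?V p = ?U p r" using V(1) by blast
    have "?U p' r - ?U p r > 0" using diff[of p' r p] that U0[OF r(1)] U1[OF r(1)] by simp
    thus ?thesis using V(2)[OF r(1), of p'] r by simp
  qed
  have V0: "?V 0 < 0" and V1: "?V 1 > 0" "?V 1 \<le> gain_H M"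
    using V(1)[of 0] V(1)[of 1] U0 U1 by force+
  obtain pl where pl: "0 \<le> pl" "pl \<le> 1" "?V pl = 0"
    using IVT[of ?V 0 0 1] V0 V1 cont by auto
  have pA: "0 < p_A M" "p_A M < 1" unfolding p_A_def using pos by (auto simp: field_simps)
  have A: "?A p = C * (p - p_A M)" for p
    using pos by (simp add: U_A_def C_def p_A_def field_simps)
  have C: "C > 0" using pos C_def by simp
  have VA: "?V (p_A M) > 0"
  proof -
    obtain r where r: "r \<in> ?R" using V(1) by blast
    have 1: "p_A M * gain_H M = (1 - p_A M) * loss_L M" using A[of "p_A M"] unfolding U_A_def by simp
    have "?U (p_A M) r = (p_A M * gain_H M) * q_H M r - ((1 - p_A M) * loss_L M) * q_L M r
      + (productivity M * r) * (p_A M * q_H M r + (1 - p_A M) * q_L M r)"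
      by (simp add: U_O_def algebra_simps)
    also have "\<dots> = (p_A M * gain_H M) * (q_H M r - q_L M r)
      + (productivity M * r) * (p_A M * q_H M r + (1 - p_A M) * q_L M r)"
      unfolding 1[symmetric] by (simp add: algebra_simps)
    also have "\<dots> > 0" using q[OF r] pA pos
      by (intro add_nonneg_pos mult_pos_pos[OF q(5)[OF r]] mult_pos_pos[where a="p_A M"]
            mult_pos_pos[where b="q_L M r"] mult_nonneg_nonneg add_pos_pos) auto
    finally show ?thesis using V(2)[OF r, of "p_A M"] by simp
  qed
  define S where "S = {p_A M..1} \<inter> {p. ?V p \<le> ?A p}"
  have "closed {p. ?V p \<le> ?A p}"
    unfolding U_A_def
    by (intro closed_Collect_le continuous_at_imp_continuous_on ballI cont continuous_intros)
  hence "compact S" unfolding S_def by (intro compact_Int_closed compact_Icc)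
  moreover have "1 \<in> S" unfolding S_def using V1 pA by (simp add: U_A_def)
  ultimately obtain pu where pu: "pu \<in> S" "\<And>p. p \<in> S \<Longrightarrow> pu \<le> p"
    using compact_attains_inf[of S] by blast
  have pu': "p_A M < pu" "pu \<le> 1"
    using pu(1) VA A[of "p_A M"] unfolding S_def by (auto simp: order_le_less)
  have acc: "?A p \<ge> max 0 (?V p) \<longleftrightarrow> pu \<le> p" if "p \<in> {0..1}" for p
  proof
    assume L: "max 0 (?V p) \<le> ?A p"
    hence "p_A M \<le> p" using A[of p] C by (simp add: zero_le_mult_iff)
    thus "pu \<le> p" using pu(2)[of p] L that unfolding S_def by auto
  next
    assume R: "pu \<le> p"
    have "?V p \<le> ?A p"
    proof -
      obtain r where r: "r \<in> ?R" "?V p = ?U p r" using V(1) by blast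
      show ?thesis
      proof (cases "pu = 1")
        case True thus ?thesis using R that V1 by (simp add: U_A_def)
      next
        case False
        define t where "t = (p - pu) / (1 - pu)"
        have "t * (1 - pu) = p - pu" using False by (simp add: t_def)
        hence "p = (1 - t) * pu + t" by (simp add: algebra_simps)
        moreover have "0 \<le> t" "t \<le> 1" using False pu' R that by (simp_all add: t_def)
        ultimately have t: "0 \<le> t" "t \<le> 1" "p = (1 - t) * pu + t" by auto
        have "?U p r = (1 - t) * ?U pu r + t * ?U 1 r"
          unfolding aff[of p r] aff[of pu r] by (subst (1 2) t(3)) (simp add: algebra_simps)
        also have "\<dots> \<le> (1 - t) * ?A pu + t * ?A 1"
        proof (intro add_mono mult_left_mono)
          show "?U pu r \<le> ?A pu" using V(2)[OF r(1), of pu] pu(1) unfolding S_def by simp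
          show "?U 1 r \<le> ?A 1" using U1[OF r(1)] by (simp add: U_A_def)
        qed (use t in auto)
        also have "\<dots> = ?A p" unfolding A by (subst t(3)) (simp add: algebra_simps)
        finally show ?thesis using r by simp
      qed
    qed
    moreover have "0 \<le> ?A p" unfolding A using C R pu' by simp
    ultimately show "max 0 (?V p) \<le> ?A p" by simp
  qed
  have Vge: "?V p \<ge> 0 \<longleftrightarrow> pl \<le> p" for p
    using mono[of p pl] mono[of pl p] pl by (cases p pl rule: linorder_cases) auto
  have pl0: "0 < pl" "pl < p_A M"
    using Vge[of 0] V0 Vge[of "p_A M"] VA pl by (auto simp: order_le_less)
  have off: "\<exists>r\<in>?R. ?U p r = ?V p" for p using V(1)[of p] by force
  have opt: "optimal_actions M p = (if pu \<le> p then {Accept} else if pl \<le> p then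
      Offer ` {r \<in> ?R. ?U p r = ?V p} else {Reject})" if "p \<in> {0..1}" for p
    unfolding optimal_actions_def using acc[OF that] Vge[of p] by simp
  have "are_cutoffs M pl pu"
    unfolding are_cutoffs_def
  proof (intro conjI set_eqI)
    fix p
    show "p \<in> {p \<in> {0..1}. Reject \<in> optimal_actions M p} \<longleftrightarrow> p \<in> {0..<pl}"
      using opt[of p] pl0 pu' pl by (auto split: if_splits)
    show "p \<in> {p \<in> {0..1}. \<exists>r. Offer r \<in> optimal_actions M p} \<longleftrightarrow> p \<in> {pl..<pu}"
      using opt[of p] off[of p] pl0 pu' by (auto split: if_splits simp: image_iff)
    show "p \<in> {p \<in> {0..1}. Accept \<in> optimal_actions M p} \<longleftrightarrow> p \<in> {pu..1}"
      using opt[of p] pl0 pu' pA by (auto split: if_splits)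
  qed (use pl0 pu' in auto)
  thus ?thesis by blast
qed

lemma cutoffs_unique:
  assumes "are_cutoffs M pl pu" "are_cutoffs M pl' pu'"
  shows "pl = pl'" "pu = pu'"
proof -
  have "{pl..<pu} = {pl'..<pu'}" "pl < pu" "pl' < pu'" using assms unfolding are_cutoffs_def by auto
  thus "pl = pl'" "pu = pu'" by (auto simp: atLeastLessThan_inj)
qed

lemma are_cutoffs_lower_upper:
  assumes "admissible M"
  shows "are_cutoffs M (lower_cutoff M) (upper_cutoff M)"
proof -
  obtain pl pu where c: "are_cutoffs M pl pu" using cutoffs_exist[OF assms] by blast
  have "lower_cutoff M = pl" "upper_cutoff M = pu"
    unfolding lower_cutoff_def upper_cutoff_def using c cutoffs_unique by (blast intro: the_equality)+
  thus ?thesis using c by simp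
qed

end

theory Submission
  imports Defs
begin

text \<open>
  Acceptance dominance at the top forces \<open>q_H < 1\<close>, because \<open>\<delta> r > 0\<close>; together with limited
  feasible recourse all completion probabilities then lie strictly between 0 and 1, so the
  truncation in their definition never binds. Hence every parameter change shifts \<open>U_O p r\<close>, or its
  gap to \<open>U_A p\<close>, in the same direction for all requirements \<open>r\<close> simultaneously (for the shock
  bound, \<open>U_O\<close> is merely rescaled), and such a uniform shift moves the cutoffs.
\<close>

section \<open>Completion probabilities and the value of recourse\<close>

lemma completion_prob_interior:
  assumes "admissible M" "r \<in> requirements M"
  shows "q_L M r = (threshold M - cost_L M r) / shock_bound M"
    and "q_H M r = (threshold M - cost_H M r) / shock_bound M"
    and "0 < q_L M r" "q_L M r < 1" "0 < q_H M r" "q_H M r < 1"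
proof -
  note q = completion_prob_bounds[OF assms]
  have g: "gain_H M > 0" and dom: "q_H M r * (gain_H M + productivity M * r) \<le> gain_H M"
    using assms
    unfolding admissible_def screening_model_def acceptance_dominance_at_top_def by auto
  show H: "q_H M r < 1"
  proof (rule ccontr)
    assume "\<not> q_H M r < 1"
    hence "q_H M r = 1" using q(3) by simp
    \<comment> \<open>With completion probability 1, dominance would bound
      \<open>gain_H M + productivity M * r\<close> by \<open>gain_H M\<close>.\<close>
    thus False using dom q(5) by simp
  qed
  show "0 < q_L M r" "0 < q_H M r" using q(1,2) by auto
  show "q_L M r < 1" using q(2) H by simp
  show "q_L M r = (threshold M - cost_L M r) / shock_bound M"
    using \<open>0 < q_L M r\<close> \<open>q_L M r < 1\<close> unfolding completion_prob_def
    by (auto simp: min_def max_def split: if_splits)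
  show "q_H M r = (threshold M - cost_H M r) / shock_bound M"
    using \<open>0 < q_H M r\<close> H unfolding completion_prob_def
    by (auto simp: min_def max_def split: if_splits)
qed

lemma V_O_witness:
  assumes "admissible M"
  obtains r where "r \<in> requirements M" "V_O M p = U_O M p r"
  using V_O_attained(1)[OF assms, of p] by blast

text \<open>For a fixed requirement, \<open>U_O\<close> is affine in the belief. Its slope is
  nonnegative because a completing H type brings a gain and, as
  \<open>productivity M * r < loss_L M\<close>, a completing L type a loss. The offer that is
  optimal at \<open>p\<close> remains available at \<open>p'\<close>.\<close>

lemma V_O_mono:
  assumes "admissible M" "p \<le> p'"
  shows "V_O M p \<le> V_O M p'"
proof -
  obtain r where r: "r \<in> requirements M" "V_O M p = U_O M p r"
    using V_O_witness[OF assms(1)] .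
  note q = completion_prob_bounds[OF assms(1) r(1)]
  have g: "gain_H M > 0"
    using assms unfolding admissible_def screening_model_def by auto
  have "0 \<le> q_H M r * (gain_H M + productivity M * r)"
    using q g by (intro mult_nonneg_nonneg) linarith+
  moreover have "0 \<le> q_L M r * (loss_L M - productivity M * r)"
    using q by (intro mult_nonneg_nonneg) linarith+
  ultimately have "0 \<le> (p' - p) *
      (q_H M r * (gain_H M + productivity M * r) + q_L M r * (loss_L M - productivity M * r))"
    using assms(2) by (intro mult_nonneg_nonneg) linarith+
  also have "\<dots> = U_O M p' r - U_O M p r"
    by (simp add: U_O_def algebra_simps)
  finally show ?thesis using V_O_attained(2)[OF assms(1) r(1), of p'] r(2) by simp
qed

section \<open>Cutoffs as extremal beliefs\<close>

lemma cutoffs_order: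
  assumes "admissible M"
  shows "0 < lower_cutoff M" "lower_cutoff M < p_A M" "p_A M < upper_cutoff M"
    "upper_cutoff M \<le> 1"
  using are_cutoffs_lower_upper[OF assms] unfolding are_cutoffs_def by auto

lemma U_A_pos_iff:
  assumes "admissible M"
  shows "0 < U_A M p \<longleftrightarrow> p_A M < p"
proof -
  have "gain_H M > 0" "loss_L M > 0"
    using assms unfolding admissible_def screening_model_def by auto
  thus ?thesis unfolding U_A_def p_A_def by (simp add: field_simps)
qed

lemma U_A_upper_cutoff_pos:
  assumes "admissible M"
  shows "0 < U_A M (upper_cutoff M)"
  using U_A_pos_iff[OF assms] cutoffs_order[OF assms] by simp

text \<open>Rejection below the cutoff requires \<open>V_O M p < 0\<close>. With
  \<open>V_O_lower_cutoff_nonneg\<close>, this makes the lower cutoff the least belief in [0,1] at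
  which \<open>V_O\<close> is nonnegative, so later arguments can avoid
  \<open>optimal_actions\<close>.\<close>

lemma lower_cutoff_le:
  assumes "admissible M" "0 \<le> p" "p \<le> 1" "0 \<le> V_O M p"
  shows "lower_cutoff M \<le> p"
proof (rule ccontr)
  assume "\<not> lower_cutoff M \<le> p"
  hence "p \<in> {p \<in> {0..1}. Reject \<in> optimal_actions M p}"
    using are_cutoffs_lower_upper[OF assms(1)] assms(2) unfolding are_cutoffs_def by auto
  thus False using assms(4) by (auto simp: optimal_actions_def split: if_splits)
qed

lemma V_O_lower_cutoff_nonneg:
  assumes "admissible M"
  shows "0 \<le> V_O M (lower_cutoff M)"
proof -
  have "lower_cutoff M \<in> {p \<in> {0..1}. \<exists>r. Offer r \<in> optimal_actions M p}"
    using are_cutoffs_lower_upper[OF assms] unfolding are_cutoffs_def by auto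
  thus ?thesis by (auto simp: optimal_actions_def split: if_splits)
qed

text \<open>The two premises on \<open>U_A\<close> together are the acceptance test against
  \<open>max 0 (V_O M p)\<close>. The cutoff itself passes this test, which gives the companion fact
  \<open>V_O_upper_cutoff_le\<close>.\<close>

lemma upper_cutoff_le:
  assumes "admissible M" "0 \<le> p" "p \<le> 1" "0 \<le> U_A M p" "V_O M p \<le> U_A M p"
  shows "upper_cutoff M \<le> p"
proof -
  have "p \<in> {p \<in> {0..1}. Accept \<in> optimal_actions M p}"
    using assms by (auto simp: optimal_actions_def)
  thus ?thesis
    using are_cutoffs_lower_upper[OF assms(1)] unfolding are_cutoffs_def by auto
qed

lemma V_O_upper_cutoff_le:
  assumes "admissible M"
  shows "V_O M (upper_cutoff M) \<le> U_A M (upper_cutoff M)"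
proof -
  have "upper_cutoff M \<in> {p \<in> {0..1}. Accept \<in> optimal_actions M p}"
    using are_cutoffs_lower_upper[OF assms] unfolding are_cutoffs_def by auto
  thus ?thesis by (auto simp: optimal_actions_def split: if_splits)
qed

section \<open>Comparison principles for two models\<close>

text \<open>The best offer of \<open>M\<close> at its own lower cutoff is still worth at least 0 in
  \<open>M'\<close>, so \<open>M'\<close> does not reject there. Only the sign of \<open>U_O\<close>
  has to carry over, which covers a rescaling of payoffs as well as a shift.\<close>

lemma lower_cutoff_mono:
  assumes M: "admissible M" and M': "admissible M'"
    and req: "requirements M' = requirements M"
    and imp: "\<And>p r. 0 < p \<Longrightarrow> p < 1 \<Longrightarrow> r \<in> requirements M \<Longrightarrow> 0 \<le> U_O M p r \<Longrightarrow> 0 \<le> U_O M' p r"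
  shows "lower_cutoff M' \<le> lower_cutoff M"
proof -
  let ?p = "lower_cutoff M"
  have p: "0 < ?p" "?p < 1" using cutoffs_order[OF M] by auto
  obtain r where r: "r \<in> requirements M" "V_O M ?p = U_O M ?p r"
    using V_O_witness[OF M] .
  have "0 \<le> U_O M' ?p r"
    using imp[OF p r(1)] r(2) V_O_lower_cutoff_nonneg[OF M] by simp
  also have "\<dots> \<le> V_O M' ?p" using V_O_attained(2)[OF M'] r(1) req by blast
  finally show ?thesis using lower_cutoff_le[OF M'] p by simp
qed

text \<open>At the lower cutoff of \<open>M\<close>, its best requirement earns a strictly positive
  payoff in \<open>M'\<close>. With that requirement fixed, \<open>U_O\<close> is continuous in the
  belief, so the payoff stays positive slightly to the left.\<close>

lemma lower_cutoff_strict_mono: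
  assumes M: "admissible M" and M': "admissible M'"
    and req: "requirements M' = requirements M"
    and imp: "\<And>p r. 0 < p \<Longrightarrow> p < 1 \<Longrightarrow> r \<in> requirements M \<Longrightarrow> 0 \<le> U_O M p r \<Longrightarrow> 0 < U_O M' p r"
  shows "lower_cutoff M' < lower_cutoff M"
proof -
  let ?p = "lower_cutoff M"
  have p: "0 < ?p" "?p < 1" using cutoffs_order[OF M] by auto
  obtain r where r: "r \<in> requirements M" "V_O M ?p = U_O M ?p r"
    using V_O_witness[OF M] .
  have "0 < U_O M' ?p r"
    using imp[OF p r(1)] r(2) V_O_lower_cutoff_nonneg[OF M] by simp
  moreover have "((\<lambda>p. U_O M' p r) \<longlongrightarrow> U_O M' ?p r) (at_left ?p)"
    unfolding U_O_def by (intro tendsto_intros)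
  ultimately have "\<forall>\<^sub>F p in at_left ?p. 0 < U_O M' p r" by (rule order_tendstoD(1)[rotated])
  moreover have "\<forall>\<^sub>F p in at_left ?p. p \<in> {0<..<?p}" using p by (intro eventually_at_leftI) auto
  ultimately have "\<forall>\<^sub>F p in at_left ?p. 0 < U_O M' p r \<and> p \<in> {0<..<?p}"
    by (rule eventually_conj)
  then obtain p' where p': "0 < U_O M' p' r" "0 < p'" "p' < ?p"
    using eventually_happens'[OF trivial_limit_at_left_real] by fastforce
  have "U_O M' p' r \<le> V_O M' p'" using V_O_attained(2)[OF M'] r(1) req by blast
  hence "lower_cutoff M' \<le> p'" using lower_cutoff_le[OF M'] p p' by simp
  thus ?thesis using p' by simp
qed

text \<open>The comparison takes place at the upper cutoff of \<open>M'\<close>: there acceptance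
  beats every offer in \<open>M'\<close>, and \<open>imp\<close> transfers this to the best offer of
  \<open>M\<close>. That cutoff exceeds \<open>p_A M'\<close>, hence the premise
  \<open>0 < U_A M' p\<close> in \<open>imp\<close>. The disjunction in \<open>interior\<close> lets
  the original model play either role; if the cutoff of \<open>M'\<close> is 1, it leaves
  \<open>upper_cutoff M < 1\<close>.\<close>

lemma upper_cutoff_mono:
  assumes M: "admissible M" and M': "admissible M'"
    and req: "requirements M' = requirements M"
    and interior: "upper_cutoff M < 1 \<or> upper_cutoff M' < 1"
    and acc: "\<And>p. 0 < p \<Longrightarrow> p < 1 \<Longrightarrow> U_A M' p \<le> U_A M p"
    and imp: "\<And>p r. 0 < p \<Longrightarrow> p < 1 \<Longrightarrow> r \<in> requirements M \<Longrightarrow> 0 < U_A M' p \<Longrightarrow>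
      U_O M' p r \<le> U_A M' p \<Longrightarrow> U_O M p r \<le> U_A M p"
  shows "upper_cutoff M \<le> upper_cutoff M'"
proof (cases "upper_cutoff M' < 1")
  case True
  let ?p = "upper_cutoff M'"
  have p: "0 < ?p" using cutoffs_order[OF M'] by auto
  obtain r where r: "r \<in> requirements M" "V_O M ?p = U_O M ?p r"
    using V_O_witness[OF M] .
  have "U_O M' ?p r \<le> U_A M' ?p"
    using V_O_attained(2)[OF M', of r ?p] V_O_upper_cutoff_le[OF M'] r(1) req by simp
  hence "V_O M ?p \<le> U_A M ?p"
    using imp[OF p True r(1)] U_A_upper_cutoff_pos[OF M'] r(2) by simp
  thus ?thesis
    using upper_cutoff_le[OF M] acc[OF p True] U_A_upper_cutoff_pos[OF M'] p True by simp
qed (use interior in auto)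

text \<open>Monotonicity of \<open>V_O\<close> replaces its continuity: just below the cutoff, \<open>V_O\<close> is no larger than
  at the cutoff, while \<open>U_A\<close> is almost as large.\<close>

lemma upper_cutoff_strict_mono:
  assumes M: "admissible M" and M': "admissible M'"
    and req: "requirements M' = requirements M"
    and interior: "upper_cutoff M < 1 \<or> upper_cutoff M' < 1"
    and acc: "\<And>p. 0 < p \<Longrightarrow> p < 1 \<Longrightarrow> U_A M' p \<le> U_A M p"
    and imp: "\<And>p r. 0 < p \<Longrightarrow> p < 1 \<Longrightarrow> r \<in> requirements M \<Longrightarrow> 0 < U_A M' p \<Longrightarrow>
      U_O M' p r \<le> U_A M' p \<Longrightarrow> U_O M p r < U_A M p"
  shows "upper_cutoff M < upper_cutoff M'"
proof (cases "upper_cutoff M' < 1")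
  case True
  let ?p = "upper_cutoff M'"
  have p: "0 < ?p" using cutoffs_order[OF M'] by auto
  obtain r where r: "r \<in> requirements M" "V_O M ?p = U_O M ?p r"
    using V_O_witness[OF M] .
  have "U_O M' ?p r \<le> U_A M' ?p"
    using V_O_attained(2)[OF M', of r ?p] V_O_upper_cutoff_le[OF M'] r(1) req by simp
  hence "max 0 (V_O M ?p) < U_A M ?p"
    using imp[OF p True r(1)] U_A_upper_cutoff_pos[OF M'] acc[OF p True] r(2) by simp
  moreover have "(U_A M \<longlongrightarrow> U_A M ?p) (at_left ?p)"
    unfolding U_A_def[abs_def] by (intro tendsto_intros)
  ultimately have "\<forall>\<^sub>F p in at_left ?p. max 0 (V_O M ?p) < U_A M p"
    by (rule order_tendstoD(1)[rotated])
  moreover have "\<forall>\<^sub>F p in at_left ?p. p \<in> {0<..<?p}" using p by (intro eventually_at_leftI) auto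
  ultimately have "\<forall>\<^sub>F p in at_left ?p. max 0 (V_O M ?p) < U_A M p \<and> p \<in> {0<..<?p}"
    by (rule eventually_conj)
  then obtain p' where p': "max 0 (V_O M ?p) < U_A M p'" "0 < p'" "p' < ?p"
    using eventually_happens'[OF trivial_limit_at_left_real] by fastforce
  have "V_O M p' \<le> V_O M ?p" using V_O_mono[OF M] p' by simp
  hence "upper_cutoff M \<le> p'" using upper_cutoff_le[OF M] p' True by simp
  thus ?thesis using p' by simp
next
  case False
  thus ?thesis using interior cutoffs_order(4)[OF M'] by auto
qed

section \<open>Effect of each primitive\<close>

text \<open>Every offer gains the extra productivity times \<open>r\<close> times the expected
  completion probability, while \<open>U_A\<close> does not involve productivity.\<close>

lemma cutoffs_productivity:
  assumes M: "admissible M" and M': "admissible (M\<lparr>productivity := d\<rparr>)"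
    and d: "d > productivity M" and interior: "upper_cutoff M < 1"
  shows "lower_cutoff (M\<lparr>productivity := d\<rparr>) < lower_cutoff M"
    and "upper_cutoff M < upper_cutoff (M\<lparr>productivity := d\<rparr>)"
proof -
  let ?M' = "M\<lparr>productivity := d\<rparr>"
  have lt: "U_O M p r < U_O ?M' p r" if p: "0 < p" "p < 1" and r: "r \<in> requirements M" for p r
  proof -
    have r0: "0 < r"
      using M r unfolding admissible_def screening_model_def by auto
    have "U_O ?M' p r - U_O M p r = (d - productivity M) * r * (p * q_H M r + (1 - p) * q_L M r)"
      by (simp add: U_O_def completion_prob_def algebra_simps)
    also have "\<dots> > 0"
      using d r0 p completion_prob_interior(3,5)[OF M r] by (intro mult_pos_pos add_pos_pos) auto
    finally show ?thesis by simp
  qed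
  have A: "U_A ?M' p = U_A M p" for p by (simp add: U_A_def)
  show "lower_cutoff ?M' < lower_cutoff M"
    by (rule lower_cutoff_strict_mono[OF M M']) (use lt in \<open>auto intro: order.strict_trans1\<close>)
  show "upper_cutoff M < upper_cutoff ?M'"
    by (rule upper_cutoff_strict_mono[OF M M'])
      (use lt interior in \<open>auto simp: A intro: order.strict_trans2\<close>)
qed

text \<open>Under limited feasible recourse the factor \<open>loss_L M - productivity M * r\<close>
  is positive: each completion by an L type is a net loss. Discouraging L types therefore makes
  recourse more valuable.\<close>

lemma U_O_cost_L:
  "U_O (M\<lparr>cost_L := K\<rparr>) p r - U_O M p r =
    (1 - p) * (loss_L M - productivity M * r) * (q_L M r - q_L (M\<lparr>cost_L := K\<rparr>) r)"
  by (simp add: U_O_def completion_prob_def algebra_simps)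

lemma cutoffs_cost_L_weak:
  assumes M: "admissible M" and M': "admissible (M\<lparr>cost_L := K\<rparr>)"
    and K: "\<forall>r\<in>requirements M. cost_L M r \<le> K r" and interior: "upper_cutoff M < 1"
  shows "lower_cutoff (M\<lparr>cost_L := K\<rparr>) \<le> lower_cutoff M"
    and "upper_cutoff M \<le> upper_cutoff (M\<lparr>cost_L := K\<rparr>)"
proof -
  let ?M' = "M\<lparr>cost_L := K\<rparr>"
  have le: "U_O M p r \<le> U_O ?M' p r" if p: "0 < p" "p < 1" and r: "r \<in> requirements M" for p r
  proof -
    have "shock_bound M > 0" using M unfolding admissible_def screening_model_def by auto
    hence "q_L ?M' r \<le> q_L M r"
      using bspec[OF K r] completion_prob_interior(1)[OF M r] completion_prob_interior(1)[OF M', of r] r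
      by (simp add: divide_right_mono)
    hence "0 \<le> U_O ?M' p r - U_O M p r"
      unfolding U_O_cost_L using p completion_prob_bounds(4)[OF M r]
      by (intro mult_nonneg_nonneg) auto
    thus ?thesis by simp
  qed
  have A: "U_A ?M' p = U_A M p" for p by (simp add: U_A_def)
  show "lower_cutoff ?M' \<le> lower_cutoff M"
    by (rule lower_cutoff_mono[OF M M']) (use le in \<open>auto intro: order_trans\<close>)
  show "upper_cutoff M \<le> upper_cutoff ?M'"
    by (rule upper_cutoff_mono[OF M M']) (use le interior in \<open>auto simp: A intro: order_trans\<close>)
qed

lemma cutoffs_cost_L_strict:
  assumes M: "admissible M" and M': "admissible (M\<lparr>cost_L := K\<rparr>)"
    and K: "\<forall>r\<in>requirements M. cost_L M r < K r" and interior: "upper_cutoff M < 1"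
  shows "lower_cutoff (M\<lparr>cost_L := K\<rparr>) < lower_cutoff M"
    and "upper_cutoff M < upper_cutoff (M\<lparr>cost_L := K\<rparr>)"
proof -
  let ?M' = "M\<lparr>cost_L := K\<rparr>"
  have lt: "U_O M p r < U_O ?M' p r" if p: "0 < p" "p < 1" and r: "r \<in> requirements M" for p r
  proof -
    have "shock_bound M > 0" using M unfolding admissible_def screening_model_def by auto
    \<comment> \<open>Since truncation is inactive in both models, the strict cost inequality
      survives in the probabilities.\<close>
    hence "q_L ?M' r < q_L M r"
      using bspec[OF K r] completion_prob_interior(1)[OF M r] completion_prob_interior(1)[OF M', of r] r
      by (simp add: divide_strict_right_mono)
    hence "0 < U_O ?M' p r - U_O M p r"
      unfolding U_O_cost_L using p completion_prob_bounds(4)[OF M r]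
      by (intro mult_pos_pos) auto
    thus ?thesis by simp
  qed
  have A: "U_A ?M' p = U_A M p" for p by (simp add: U_A_def)
  show "lower_cutoff ?M' < lower_cutoff M"
    by (rule lower_cutoff_strict_mono[OF M M']) (use lt in \<open>auto intro: order.strict_trans1\<close>)
  show "upper_cutoff M < upper_cutoff ?M'"
    by (rule upper_cutoff_strict_mono[OF M M'])
      (use lt interior in \<open>auto simp: A intro: order.strict_trans2\<close>)
qed

text \<open>All offers are multiplied by the same factor \<open>c\<close> in (0,1). Their signs
  persist, so the lower cutoff is compared in both directions; acceptance is not scaled down and
  becomes relatively better.\<close>

lemma cutoffs_shock_bound:
  assumes M: "admissible M" and M': "admissible (M\<lparr>shock_bound := e\<rparr>)"
    and e: "e > shock_bound M" and interior: "upper_cutoff M < 1"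
  shows "lower_cutoff (M\<lparr>shock_bound := e\<rparr>) = lower_cutoff M"
    and "upper_cutoff (M\<lparr>shock_bound := e\<rparr>) < upper_cutoff M"
proof -
  let ?M' = "M\<lparr>shock_bound := e\<rparr>"
  define c where "c = shock_bound M / e"
  have s: "shock_bound M > 0" using M unfolding admissible_def screening_model_def by auto
  have c: "0 < c" "c < 1" unfolding c_def using s e by auto
  have scale: "U_O ?M' p r = c * U_O M p r" if r: "r \<in> requirements M" for p r
  proof -
    have "q_L ?M' r = c * q_L M r" "q_H ?M' r = c * q_H M r"
      using completion_prob_interior(1,2)[OF M r] completion_prob_interior(1,2)[OF M', of r] r s e
      by (auto simp: c_def)
    thus ?thesis by (simp add: U_O_def algebra_simps)
  qed
  have A: "U_A ?M' p = U_A M p" for p by (simp add: U_A_def)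
  show "lower_cutoff ?M' = lower_cutoff M"
  proof (rule antisym)
    show "lower_cutoff ?M' \<le> lower_cutoff M"
      by (rule lower_cutoff_mono[OF M M']) (use scale c in auto)
    show "lower_cutoff M \<le> lower_cutoff ?M'"
      by (rule lower_cutoff_mono[OF M' M]) (use scale c in \<open>simp_all add: zero_le_mult_iff\<close>)
  qed
  show "upper_cutoff ?M' < upper_cutoff M"
  \<comment> \<open>The roles are exchanged: the model with the larger shock bound has the smaller
    cutoff. Positivity of \<open>U_A M p\<close> makes \<open>c * U_A M p\<close> strictly smaller
    than \<open>U_A M p\<close>.\<close>
  proof (rule upper_cutoff_strict_mono[OF M' M])
    fix p r assume "r \<in> requirements ?M'" and pos: "0 < U_A M p" and le: "U_O M p r \<le> U_A M p"
    hence "U_O ?M' p r = c * U_O M p r" using scale by simp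
    also have "\<dots> \<le> c * U_A M p" using c le by simp
    also have "\<dots> < U_A M p" using c pos by simp
    finally show "U_O ?M' p r < U_A ?M' p" by (simp add: A)
  qed (use interior A in auto)
qed

text \<open>Acceptance bears the whole extra loss \<open>(1 - p) * (a - loss_L M)\<close>, an offer
  only the fraction \<open>q_L M r\<close>, strictly between 0 and 1. Recourse thus worsens against
  rejection but improves against acceptance.\<close>

lemma cutoffs_loss_L:
  assumes M: "admissible M" and M': "admissible (M\<lparr>loss_L := a\<rparr>)"
    and a: "a > loss_L M" and interior: "upper_cutoff M < 1"
  shows "lower_cutoff M < lower_cutoff (M\<lparr>loss_L := a\<rparr>)"
    and "upper_cutoff M < upper_cutoff (M\<lparr>loss_L := a\<rparr>)"
proof -
  let ?M' = "M\<lparr>loss_L := a\<rparr>"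
  have O: "U_O M p r - U_O ?M' p r = (1 - p) * (a - loss_L M) * q_L M r" for p r
    by (simp add: U_O_def completion_prob_def algebra_simps)
  have A: "U_A M p - U_A ?M' p = (1 - p) * (a - loss_L M)" for p
    by (simp add: U_A_def algebra_simps)
  have lt: "U_O ?M' p r < U_O M p r" "U_O M p r - U_O ?M' p r < U_A M p - U_A ?M' p"
    if p: "0 < p" "p < 1" and r: "r \<in> requirements M" for p r
  proof -
    have "0 < (1 - p) * (a - loss_L M)" using p a by simp
    moreover from this have "0 < (1 - p) * (a - loss_L M) * q_L M r"
      using completion_prob_interior(3)[OF M r] by (rule mult_pos_pos)
    moreover from calculation(1) have "(1 - p) * (a - loss_L M) * q_L M r < (1 - p) * (a - loss_L M) * 1"
      by (rule mult_strict_left_mono[OF completion_prob_interior(4)[OF M r]])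
    ultimately show "U_O ?M' p r < U_O M p r" "U_O M p r - U_O ?M' p r < U_A M p - U_A ?M' p"
      using O[of p r] A[of p] by linarith+
  qed
  show "lower_cutoff M < lower_cutoff ?M'"
    by (rule lower_cutoff_strict_mono[OF M' M]) (use lt in \<open>auto intro: order.strict_trans1\<close>)
  show "upper_cutoff M < upper_cutoff ?M'"
  proof (rule upper_cutoff_strict_mono[OF M M'])
    fix p :: real assume "0 < p" "p < 1"
    hence "0 < (1 - p) * (a - loss_L M)" using a by simp
    thus "U_A ?M' p \<le> U_A M p" using A[of p] by linarith
  next
    fix p r assume "0 < p" "p < 1" "r \<in> requirements M" "U_O ?M' p r \<le> U_A ?M' p"
    thus "U_O M p r < U_A M p" using lt(2)[of p r] by simp
  qed (use interior in auto)
qed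

text \<open>Acceptance receives the whole extra gain \<open>p * (a - gain_H M)\<close>, an offer
  only the fraction \<open>q_H M r\<close>, strictly between 0 and 1. Recourse thus improves against
  rejection but worsens against acceptance.\<close>

lemma cutoffs_gain_H:
  assumes M: "admissible M" and M': "admissible (M\<lparr>gain_H := a\<rparr>)"
    and a: "a > gain_H M" and interior: "upper_cutoff M < 1"
  shows "lower_cutoff (M\<lparr>gain_H := a\<rparr>) < lower_cutoff M"
    and "upper_cutoff (M\<lparr>gain_H := a\<rparr>) < upper_cutoff M"
proof -
  let ?M' = "M\<lparr>gain_H := a\<rparr>"
  have O: "U_O ?M' p r - U_O M p r = p * (a - gain_H M) * q_H M r" for p r
    by (simp add: U_O_def completion_prob_def algebra_simps)
  have A: "U_A ?M' p - U_A M p = p * (a - gain_H M)" for p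
    by (simp add: U_A_def algebra_simps)
  have lt: "U_O M p r < U_O ?M' p r" "U_O ?M' p r - U_O M p r < U_A ?M' p - U_A M p"
    if p: "0 < p" and r: "r \<in> requirements M" for p r
  proof -
    have "0 < p * (a - gain_H M)" using p a by simp
    moreover from this have "0 < p * (a - gain_H M) * q_H M r"
      using completion_prob_interior(5)[OF M r] by (rule mult_pos_pos)
    moreover from calculation(1) have "p * (a - gain_H M) * q_H M r < p * (a - gain_H M) * 1"
      by (rule mult_strict_left_mono[OF completion_prob_interior(6)[OF M r]])
    ultimately show "U_O M p r < U_O ?M' p r" "U_O ?M' p r - U_O M p r < U_A ?M' p - U_A M p"
      using O[of p r] A[of p] by linarith+
  qed
  show "lower_cutoff ?M' < lower_cutoff M"
    by (rule lower_cutoff_strict_mono[OF M M']) (use lt in \<open>auto intro: order.strict_trans1\<close>)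
  show "upper_cutoff ?M' < upper_cutoff M"
  proof (rule upper_cutoff_strict_mono[OF M' M])
    fix p :: real assume "0 < p" "p < 1"
    hence "0 < p * (a - gain_H M)" using a by simp
    thus "U_A M p \<le> U_A ?M' p" using A[of p] by linarith
  next
    fix p r assume "0 < p" "r \<in> requirements ?M'" "U_O M p r \<le> U_A M p"
    thus "U_O ?M' p r < U_A ?M' p" using lt(2)[of p r] by simp
  qed (use interior in auto)
qed

theorem proposition3:
  fixes M :: screening
  assumes "admissible M"
    and "upper_cutoff M < 1"
  shows
    "(\<forall>d. d > productivity M \<and> admissible (M\<lparr>productivity := d\<rparr>) \<longrightarrow>
        lower_cutoff (M\<lparr>productivity := d\<rparr>) < lower_cutoff M \<and>
        upper_cutoff (M\<lparr>productivity := d\<rparr>) > upper_cutoff M) \<and>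
     (\<forall>K. (\<forall>r\<in>requirements M. K r \<ge> cost_L M r) \<and> admissible (M\<lparr>cost_L := K\<rparr>) \<longrightarrow>
        lower_cutoff (M\<lparr>cost_L := K\<rparr>) \<le> lower_cutoff M \<and>
        upper_cutoff (M\<lparr>cost_L := K\<rparr>) \<ge> upper_cutoff M \<and>
        ((\<forall>r\<in>requirements M. K r > cost_L M r) \<longrightarrow>
           lower_cutoff (M\<lparr>cost_L := K\<rparr>) < lower_cutoff M \<and>
           upper_cutoff (M\<lparr>cost_L := K\<rparr>) > upper_cutoff M)) \<and>
     (\<forall>e. e > shock_bound M \<and> admissible (M\<lparr>shock_bound := e\<rparr>) \<longrightarrow>
        lower_cutoff (M\<lparr>shock_bound := e\<rparr>) = lower_cutoff M \<and>
        upper_cutoff (M\<lparr>shock_bound := e\<rparr>) < upper_cutoff M) \<and>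
     (\<forall>a. a > loss_L M \<and> admissible (M\<lparr>loss_L := a\<rparr>) \<longrightarrow>
        lower_cutoff (M\<lparr>loss_L := a\<rparr>) > lower_cutoff M \<and>
        upper_cutoff (M\<lparr>loss_L := a\<rparr>) > upper_cutoff M) \<and>
     (\<forall>a. a > gain_H M \<and> admissible (M\<lparr>gain_H := a\<rparr>) \<longrightarrow>
        lower_cutoff (M\<lparr>gain_H := a\<rparr>) < lower_cutoff M \<and>
        upper_cutoff (M\<lparr>gain_H := a\<rparr>) < upper_cutoff M)"
  by (intro conjI allI impI; elim conjE)
    (simp_all add: assms cutoffs_productivity cutoffs_cost_L_weak cutoffs_cost_L_strict
      cutoffs_shock_bound cutoffs_loss_L cutoffs_gain_H)

end
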